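(* For every $n\geq 6$, the generalized Petersen graph $GP(n,2)$ is $\mathcal{S}$, i.e. Staller wins the Maker--Breaker total domination game on $GP(n,2)$, no matter which player moves first.
   Context: The Maker--Breaker total domination (MBTD) game on a graph $G$: two players, Dominator and Staller, alternately claim one previously unclaimed vertex of $G$ per move. Staller wins if at some point she has claimed all vertices of the open neighbourhood $N_G(v)$ of some vertex $v$ of $G$; otherwise Dominator wins. A graph is $\mathcal{S}$ if Staller has a winning strategy regardless of who moves first. For $n\geq 3$ and $1\leq k\leq n-1$, the generalized Petersen graph $GP(n,k)$ has vertex set $\{u_0,\dots,u_{n-1},v_0,\dots,v_{n-1}\}$ and edge set consisting of all edges of the form $u_iu_{i+1}$, $u_iv_i$, $v_iv_{i+k}$, where $i$ is an integer and all subscripts are read modulo $n$. *)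

theory Defs
  imports Main
begin

type_synonym 'a graph = "'a set \<times> 'a set set"

abbreviation verts :: "'a graph \<Rightarrow> 'a set" where
  "verts G \<equiv> fst G"

abbreviation edges :: "'a graph \<Rightarrow> 'a set set" where
  "edges G \<equiv> snd G"

definition simple_graph :: "'a graph \<Rightarrow> bool" where
  "simple_graph G \<longleftrightarrow>
     finite (verts G) \<and> (\<forall>e \<in> edges G. e \<subseteq> verts G \<and> card e = 2)"

definition open_nbhd :: "'a graph \<Rightarrow> 'a \<Rightarrow> 'a set" where
  "open_nbhd G v = {w. {v, w} \<in> edges G}"

datatype player = Dominator | Staller

fun opponent :: "player \<Rightarrow> player" where
  "opponent Dominator = Staller"
| "opponent Staller = Dominator"

(* The player making move number i, counted from 0. *)
definition mover :: "player \<Rightarrow> nat \<Rightarrow> player" where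
  "mover first i = (if even i then first else opponent first)"

(* A history lists the vertices claimed so far, in the order in which they were claimed. *)
definition legal_history :: "'a graph \<Rightarrow> 'a list \<Rightarrow> bool" where
  "legal_history G xs \<longleftrightarrow> distinct xs \<and> set xs \<subseteq> verts G"

definition claimed :: "player \<Rightarrow> player \<Rightarrow> 'a list \<Rightarrow> 'a set" where
  "claimed first p xs = {xs ! i | i. i < length xs \<and> mover first i = p}"

(* Moves go on until no vertex is left; moves made after the game has been decided
   are irrelevant. Plays are lists, so this is meant for finite graphs. *)
definition complete_play :: "'a graph \<Rightarrow> 'a list \<Rightarrow> bool" where
  "complete_play G xs \<longleftrightarrow> legal_history G xs \<and> set xs = verts G"

definition staller_wins_play :: "'a graph \<Rightarrow> player \<Rightarrow> 'a list \<Rightarrow> bool" where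
  "staller_wins_play G first xs \<longleftrightarrow>
     (\<exists>t \<le> length xs. \<exists>v \<in> verts G. open_nbhd G v \<subseteq> claimed first Staller (take t xs))"

(* A strategy assigns to each history the vertex to be claimed next. It has to
   prescribe an unclaimed vertex whenever it is its owner's turn and one is left. *)
definition legal_strategy :: "'a graph \<Rightarrow> player \<Rightarrow> player \<Rightarrow> ('a list \<Rightarrow> 'a) \<Rightarrow> bool" where
  "legal_strategy G first p \<sigma> \<longleftrightarrow>
     (\<forall>xs. legal_history G xs \<and> set xs \<noteq> verts G \<and> mover first (length xs) = p
        \<longrightarrow> \<sigma> xs \<in> verts G - set xs)"

definition follows :: "player \<Rightarrow> player \<Rightarrow> ('a list \<Rightarrow> 'a) \<Rightarrow> 'a list \<Rightarrow> bool" where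
  "follows first p \<sigma> xs \<longleftrightarrow>
     (\<forall>i < length xs. mover first i = p \<longrightarrow> xs ! i = \<sigma> (take i xs))"

definition staller_winning_strategy ::
    "'a graph \<Rightarrow> player \<Rightarrow> ('a list \<Rightarrow> 'a) \<Rightarrow> bool" where
  "staller_winning_strategy G first \<sigma> \<longleftrightarrow>
     legal_strategy G first Staller \<sigma> \<and>
     (\<forall>xs. complete_play G xs \<and> follows first Staller \<sigma> xs \<longrightarrow> staller_wins_play G first xs)"

definition graph_S :: "'a graph \<Rightarrow> bool" where
  "graph_S G \<longleftrightarrow> (\<forall>first. \<exists>\<sigma>. staller_winning_strategy G first \<sigma>)"

(* U i and V i stand for u_i and v_i. *)
datatype gp_vertex = U nat | V nat

definition GP :: "nat \<Rightarrow> nat \<Rightarrow> gp_vertex graph" where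
  "GP n k =
     (U ` {..<n} \<union> V ` {..<n},
      {{U i, U ((i + 1) mod n)} | i. i < n} \<union>
      {{U i, V i} | i. i < n} \<union>
      {{V i, V ((i + k) mod n)} | i. i < n})"

lemma mod_shift_neq:
  fixes i k n :: nat
  assumes "i < n" "1 \<le> k" "k < n"
  shows "i \<noteq> (i + k) mod n"
proof (cases "i + k < n")
  case True
  then show ?thesis using assms by simp
next
  case False
  then have "(i + k) mod n = i + k - n"
    using assms by (simp add: le_mod_geq)
  then show ?thesis using assms False by simp
qed

lemma simple_graph_GP:
  assumes "3 \<le> n" "1 \<le> k" "k \<le> n - 1"
  shows "simple_graph (GP n k)"
  using assms mod_shift_neq[of _ n k] mod_shift_neq[of _ n 1]
  by (fastforce simp: simple_graph_def GP_def card_insert_if)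

end

theory Submission
  imports Defs "HOL-Number_Theory.Cong"
begin

text \<open>
  All open neighbourhoods in \<open>GP n 2\<close> have at most three vertices, so Staller can play with
  forcing moves: as soon as she owns all of a neighbourhood but one vertex, Dominator has to reply
  there. A forcing line is a sequence of such moves that ends with two threats at once and hence
  wins. A line works whenever its vertices are unclaimed, so Staller wins if, after a quiet opening
  move, she has several lines that share no common vertex: Dominator's single reply leaves at
  least one of them intact (\<open>winning_opening_wins\<close>).

  It is enough to answer a first move of Dominator with such an opening that avoids the claimed
  vertex; if Staller starts, the same opening works on the empty board. By rotation
  Dominator's first move may be taken to be \<open>U 0\<close> or \<open>V 0\<close>. For \<open>n \<ge> 8\<close> an
  opening with three lines fits into the seven consecutive columns 1 to 7 and so avoids
  column 0 (\<open>opening_window\<close>). For \<open>n = 6\<close> and \<open>n = 7\<close> seven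
  consecutive columns include column 0, but neighbourhoods that wrap around the cycle
  give other lines, and each of the two first moves gets its own opening.

  Strategies are functions of histories, whereas the argument concerns positions. The inductive
  predicate \<open>winning\<close> describes the positions from which Staller wins, and
  \<open>winning_strategyI\<close> turns a winning initial position into a strategy.
\<close>

section \<open>Winning positions and strategies\<close>

text \<open>
  In \<open>winning G p S D\<close> the vertices in \<open>S\<close> belong to Staller, those in \<open>D\<close> to Dominator, and
  \<open>p\<close> is to move. The rule for Dominator demands a free vertex: otherwise a full board
  without a completed neighbourhood would vacuously count as won by Staller.
\<close>
inductive winning :: "'a graph \<Rightarrow> player \<Rightarrow> 'a set \<Rightarrow> 'a set \<Rightarrow> bool" for G :: "'a graph" where
  won: "v \<in> verts G \<Longrightarrow> open_nbhd G v \<subseteq> S \<Longrightarrow> winning G p S D"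
| staller: "x \<in> verts G - (S \<union> D) \<Longrightarrow> winning G Dominator (insert x S) D \<Longrightarrow> winning G Staller S D"
| dominator: "verts G - (S \<union> D) \<noteq> {} \<Longrightarrow>
    (\<And>y. y \<in> verts G - (S \<union> D) \<Longrightarrow> winning G Staller S (insert y D)) \<Longrightarrow> winning G Dominator S D"

lemma mover_Suc: "mover first (Suc i) = opponent (mover first i)"
  by (cases first) (auto simp: mover_def)

lemma claimed_append:
  "claimed first p (xs @ [x]) =
     (if mover first (length xs) = p then insert x (claimed first p xs) else claimed first p xs)"
proof -
  have image: "claimed first p ys = (!) ys ` {i. i < length ys \<and> mover first i = p}" for ys :: "'a list"
    unfolding claimed_def by blast
  have "{i. i < length (xs @ [x]) \<and> mover first i = p} = {i. i < length xs \<and> mover first i = p} \<union>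
      (if mover first (length xs) = p then {length xs} else {})"
    by (auto simp: less_Suc_eq)
  moreover have "(!) (xs @ [x]) ` {i. i < length xs \<and> mover first i = p} = claimed first p xs"
    unfolding image by (intro image_cong) (auto simp: nth_append)
  ultimately show ?thesis
    unfolding image[of "xs @ [x]"] image_Un by simp
qed

lemma claimed_Nil: "claimed first p [] = {}"
  by (simp add: claimed_def)

lemma set_eq_claimed: "set xs = claimed first Staller xs \<union> claimed first Dominator xs"
proof -
  have "mover first i = Staller \<or> mover first i = Dominator" for i
    by (cases "mover first i") auto
  then show ?thesis
    unfolding claimed_def set_conv_nth by blast
qed

text \<open>
  The second alternative keeps the strategy legal in positions that are not winning; these
  never arise in plays that follow it from a winning start.
\<close>
definition strategy :: "'a graph \<Rightarrow> player \<Rightarrow> 'a list \<Rightarrow> 'a" where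
  "strategy G first xs =
    (let good = (\<lambda>x. x \<in> verts G - set xs \<and>
        winning G Dominator (insert x (claimed first Staller xs)) (claimed first Dominator xs))
     in if \<exists>x. good x then SOME x. good x else SOME x. x \<in> verts G - set xs)"

lemma strategy_legal: "legal_strategy G first Staller (strategy G first)"
  unfolding legal_strategy_def
proof (intro allI impI)
  fix xs assume a: "legal_history G xs \<and> set xs \<noteq> verts G \<and> mover first (length xs) = Staller"
  then have free: "\<exists>x. x \<in> verts G - set xs"
    by (auto simp: legal_history_def)
  show "strategy G first xs \<in> verts G - set xs"
  proof (cases "\<exists>x. x \<in> verts G - set xs \<and>
      winning G Dominator (insert x (claimed first Staller xs)) (claimed first Dominator xs)")
    case True
    from someI_ex[OF this] True show ?thesis
      unfolding strategy_def Let_def by simp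
  next
    case False
    from someI_ex[OF free] False show ?thesis
      unfolding strategy_def Let_def by (simp only: if_False)
  qed
qed

lemma strategy_keeps_winning:
  assumes "\<exists>x. x \<in> verts G - set xs \<and>
    winning G Dominator (insert x (claimed first Staller xs)) (claimed first Dominator xs)"
  shows "winning G Dominator (insert (strategy G first xs) (claimed first Staller xs))
    (claimed first Dominator xs)"
  using someI_ex[OF assms] assms unfolding strategy_def Let_def by simp

text \<open>
  Along a play that follows the strategy, every position stays winning as long as no
  neighbourhood has been completed. The final position has no free vertex, so it can only be
  winning because a neighbourhood is complete.
\<close>
lemma winning_strategyI:
  assumes win: "winning G first {} {}"
  shows "staller_winning_strategy G first (strategy G first)"
  unfolding staller_winning_strategy_def
proof (intro conjI allI impI)
  show "legal_strategy G first Staller (strategy G first)"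
    by (rule strategy_legal)
next
  fix xs assume "complete_play G xs \<and> follows first Staller (strategy G first) xs"
  then have dist: "distinct xs" and sx: "set xs = verts G"
    and fol: "\<And>i. i < length xs \<Longrightarrow> mover first i = Staller \<Longrightarrow> xs ! i = strategy G first (take i xs)"
    by (auto simp: complete_play_def legal_history_def follows_def)
  let ?S = "\<lambda>t. claimed first Staller (take t xs)"
  let ?D = "\<lambda>t. claimed first Dominator (take t xs)"
  show "staller_wins_play G first xs"
  proof (rule ccontr)
    assume "\<not> staller_wins_play G first xs"
    then have nw: "\<not> open_nbhd G v \<subseteq> ?S t" if "t \<le> length xs" "v \<in> verts G" for t v
      using that by (auto simp: staller_wins_play_def)
    have "winning G (mover first t) (?S t) (?D t)" if "t \<le> length xs" for t
      using that
    proof (induction t)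
      case 0
      then show ?case using win by (simp add: claimed_Nil mover_def)
    next
      case (Suc t)
      then have t: "t < length xs" and IH: "winning G (mover first t) (?S t) (?D t)"
        by auto
      have tk: "take (Suc t) xs = take t xs @ [xs ! t]"
        using t by (simp add: take_Suc_conv_app_nth)
      have len: "min (length xs) t = t" using t by simp
      have free: "xs ! t \<in> verts G - set (take t xs)"
        using distinct_take[OF dist, of "Suc t"] nth_mem[OF t] sx unfolding tk by simp
      have un: "set (take t xs) = ?S t \<union> ?D t"
        by (rule set_eq_claimed)
      show ?case
        using IH
      proof cases
        case (won v)
        then show ?thesis using nw t by auto
      next
        case (staller x)
        have "winning G Dominator (insert (strategy G first (take t xs)) (?S t)) (?D t)"
          by (rule strategy_keeps_winning) (use staller un in blast)
        then show ?thesis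
          using staller fol[OF t] by (simp add: tk claimed_append len mover_Suc)
      next
        case dominator
        then have "winning G Staller (?S t) (insert (xs ! t) (?D t))"
          using free un by blast
        then show ?thesis
          using dominator by (simp add: tk claimed_append len mover_Suc)
      qed
    qed
    from this[of "length xs"]
    have "winning G (mover first (length xs)) (?S (length xs)) (?D (length xs))" by blast
    then show False
    proof cases
      case (won v)
      then show ?thesis using nw[of "length xs"] by simp
    qed (use sx set_eq_claimed[of xs first] in auto)
  qed
qed

section \<open>Forcing lines and openings\<close>

definition threat :: "'a graph \<Rightarrow> 'a set \<Rightarrow> 'a \<Rightarrow> bool" where
  "threat G S r \<longleftrightarrow> (\<exists>v \<in> verts G. open_nbhd G v \<subseteq> insert r S)"

text \<open>
  A line lists alternately a move of Staller and the reply that it forces; the last move of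
  Staller is followed by the two vertices that it threatens to take.
\<close>
fun winning_line :: "'a graph \<Rightarrow> 'a set \<Rightarrow> 'a list \<Rightarrow> bool" where
  "winning_line G S [x, r, r'] \<longleftrightarrow> threat G (insert x S) r \<and> threat G (insert x S) r'"
| "winning_line G S (x # r # ys) \<longleftrightarrow> threat G (insert x S) r \<and> winning_line G (insert x S) ys"
| "winning_line G S ys \<longleftrightarrow> False"

lemma winning_threat:
  assumes "threat G S r" "r \<in> verts G - (S \<union> D)"
  shows "winning G Staller S D"
  using assms unfolding threat_def by (meson winning.staller winning.won)

lemma forced_reply:
  assumes "threat G S r" "r \<in> verts G - (S \<union> D)" "winning G Staller S (insert r D)"
  shows "winning G Dominator S D"
proof (rule winning.dominator)
  fix y assume "y \<in> verts G - (S \<union> D)"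
  then show "winning G Staller S (insert y D)"
    using assms winning_threat[of G S r "insert y D"] by (cases "y = r") auto
qed (use assms in auto)

lemma winning_line_wins:
  assumes "winning_line G S ys" "distinct ys" "set ys \<subseteq> verts G - (S \<union> D)"
  shows "winning G Staller S D"
  using assms
proof (induction G S ys arbitrary: D rule: winning_line.induct)
  case (1 G S x r r')
  have "winning G Staller (insert x S) (insert r D)"
    by (rule winning_threat[of _ _ r']) (use 1 in auto)
  then have "winning G Dominator (insert x S) D"
    by (rule forced_reply[rotated 2]) (use 1 in auto)
  then show ?case by (rule winning.staller[rotated]) (use 1 in auto)
next
  case ("2_1" G S x r)
  then show ?case by simp
next
  case ("2_2" G S x r y z ys)
  have "winning G Staller (insert x S) (insert r D)"
    by (rule "2_2.IH") (use "2_2.prems" in auto)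
  then have "winning G Dominator (insert x S) D"
    by (rule forced_reply[rotated 2]) (use "2_2.prems" in auto)
  then show ?case by (rule winning.staller[rotated]) (use "2_2.prems" in auto)
qed auto

definition winning_opening :: "'a graph \<Rightarrow> 'a \<Rightarrow> 'a list set \<Rightarrow> bool" where
  "winning_opening G x L \<longleftrightarrow>
     (\<forall>ys\<in>L. distinct (x # ys) \<and> insert x (set ys) \<subseteq> verts G \<and> winning_line G {x} ys) \<and>
     (\<Inter>ys\<in>L. set ys) = {}"

text \<open>
  Whatever Dominator replies to the opening move, some line avoids the reply because the lines
  have no vertex in common. \<open>D\<close> is a parameter so that the same opening serves both after
  a first move of Dominator and on the empty board.
\<close>
lemma winning_opening_wins:
  assumes "winning_opening G x L" "\<forall>ys\<in>L. D \<inter> insert x (set ys) = {}" "L \<noteq> {}"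
  shows "winning G Staller {} D"
proof -
  obtain zs where zs: "zs \<in> L" using assms by blast
  have line: "distinct (x # ys)" "insert x (set ys) \<subseteq> verts G" "winning_line G {x} ys"
    "D \<inter> insert x (set ys) = {}" if "ys \<in> L" for ys
    using assms that unfolding winning_opening_def by blast+
  have "zs \<noteq> []" using line(3)[OF zs] by auto
  then obtain z where z: "z \<in> set zs" by (cases zs) auto
  have "winning G Dominator {x} D"
  proof (rule winning.dominator)
    show "verts G - ({x} \<union> D) \<noteq> {}" using line[OF zs] z by auto
  next
    fix y assume y: "y \<in> verts G - ({x} \<union> D)"
    obtain ys where ys: "ys \<in> L" "y \<notin> set ys"
      using assms(1) unfolding winning_opening_def by blast
    show "winning G Staller {x} (insert y D)"
      by (rule winning_line_wins[of _ _ ys]) (use line[OF ys(1)] ys(2) in auto)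
  qed
  then show ?thesis
    by (rule winning.staller[rotated]) (use line[OF zs] in auto)
qed

section \<open>Rotations of generalized Petersen graphs\<close>

lemma winning_automorphism:
  assumes "winning G p S D" "S \<union> D \<subseteq> verts G" "bij_betw f (verts G) (verts G)"
    and nb: "\<And>v. v \<in> verts G \<Longrightarrow> open_nbhd G (f v) \<subseteq> f ` open_nbhd G v"
  shows "winning G p (f ` S) (f ` D)"
  proof -
  have rest: "verts G - (f ` S \<union> f ` D) = f ` (verts G - (S \<union> D))" if "S \<union> D \<subseteq> verts G" for S D
  proof -
    have "inj_on f (verts G)" "f ` verts G = verts G"
      using assms(3) by (auto simp: bij_betw_def)
    then show ?thesis
      using inj_on_image_set_diff[of f "verts G" "verts G" "S \<union> D"] that
      by (simp add: image_Un Diff_subset)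
  qed
  show ?thesis
    using assms(1,2)
  proof induction
    case (won v S p D)
    then have "f v \<in> verts G" "open_nbhd G (f v) \<subseteq> f ` S"
      using nb[of v] bij_betwE[OF assms(3)] by blast+
    then show ?case by (rule winning.won)
  next
    case (staller x S D)
    then have "f x \<in> verts G - (f ` S \<union> f ` D)"
      using rest[of S D] by blast
    moreover have "winning G Dominator (insert (f x) (f ` S)) (f ` D)"
      using staller by simp
    ultimately show ?case by (rule winning.staller)
  next
    case (dominator S D)
    note rest = rest[OF dominator.prems]
    show ?case
    proof (rule winning.dominator)
      show "verts G - (f ` S \<union> f ` D) \<noteq> {}" using rest dominator.hyps by simp
    next
      fix y assume "y \<in> verts G - (f ` S \<union> f ` D)"
      then obtain y' where y': "y' \<in> verts G - (S \<union> D)" "y = f y'" using rest by auto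
      have "winning G Staller (f ` S) (f ` insert y' D)"
        using dominator.IH[OF y'(1)] dominator.prems y'(1) by auto
      then show "winning G Staller (f ` S) (insert y (f ` D))" using y' by simp
    qed
  qed
qed

fun rotate_gp :: "nat \<Rightarrow> nat \<Rightarrow> gp_vertex \<Rightarrow> gp_vertex" where
  "rotate_gp n c (U i) = U ((i + c) mod n)"
| "rotate_gp n c (V i) = V ((i + c) mod n)"

lemma verts_GP: "verts (GP n k) = U ` {..<n} \<union> V ` {..<n}"
  by (simp add: GP_def)

lemma rotate_gp_inverse:
  assumes "c \<le> n" "v \<in> verts (GP n k)"
  shows "rotate_gp n c (rotate_gp n (n - c) v) = v" "rotate_gp n (n - c) (rotate_gp n c v) = v"
proof -
  have "((i + a) mod n + b) mod n = i" if "a + b = n" "i < n" for i a b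
    using that by (simp add: mod_simps add.assoc)
  from this[of "n - c" c] this[of c "n - c"]
  show "rotate_gp n c (rotate_gp n (n - c) v) = v" "rotate_gp n (n - c) (rotate_gp n c v) = v"
    using assms by (auto simp: GP_def)
qed

lemma rotate_gp_verts: "v \<in> verts (GP n k) \<Longrightarrow> rotate_gp n c v \<in> verts (GP n k)"
  by (auto simp: GP_def)

lemma rotate_gp_edges:
  assumes "{v, w} \<in> edges (GP n k)"
  shows "{rotate_gp n c v, rotate_gp n c w} \<in> edges (GP n k)"
proof -
  have shift: "((i + j) mod n + c) mod n = ((i + c) mod n + j) mod n" for i j
    by (simp add: mod_simps ac_simps)
  have "rotate_gp n c ` e \<in> edges (GP n k)" if e: "e \<in> edges (GP n k)" for e
  proof -
    consider i where "i < n" "e = {U i, U ((i + 1) mod n)}"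
      | i where "i < n" "e = {U i, V i}"
      | i where "i < n" "e = {V i, V ((i + k) mod n)}"
      using e unfolding GP_def snd_conv by blast
    then show ?thesis
    proof cases
      case 1
      then have "rotate_gp n c ` e = {U ((i + c) mod n), U (((i + c) mod n + 1) mod n)}" "(i + c) mod n < n"
        by (simp_all add: shift[of i 1, simplified])
      then show ?thesis unfolding GP_def snd_conv by blast
    next
      case 2
      then have "rotate_gp n c ` e = {U ((i + c) mod n), V ((i + c) mod n)}" "(i + c) mod n < n"
        by simp_all
      then show ?thesis unfolding GP_def snd_conv by blast
    next
      case 3
      then have "rotate_gp n c ` e = {V ((i + c) mod n), V (((i + c) mod n + k) mod n)}" "(i + c) mod n < n"
        by (simp_all add: shift)
      then show ?thesis unfolding GP_def snd_conv by blast
    qed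
  qed
  from this[OF assms] show ?thesis by simp
qed

lemma edges_GP_verts: "{v, w} \<in> edges (GP n k) \<Longrightarrow> w \<in> verts (GP n k)"
  unfolding GP_def by (auto simp: doubleton_eq_iff)

lemma winning_rotate_gp:
  assumes "winning (GP n k) p S D" "S \<union> D \<subseteq> verts (GP n k)" "c \<le> n"
  shows "winning (GP n k) p (rotate_gp n c ` S) (rotate_gp n c ` D)"
proof (rule winning_automorphism[OF assms(1,2)])
  show "bij_betw (rotate_gp n c) (verts (GP n k)) (verts (GP n k))"
    by (rule bij_betw_byWitness[where f' = "rotate_gp n (n - c)"])
      (use rotate_gp_inverse[OF assms(3)] rotate_gp_verts in auto)
next
  fix v assume v: "v \<in> verts (GP n k)"
  show "open_nbhd (GP n k) (rotate_gp n c v) \<subseteq> rotate_gp n c ` open_nbhd (GP n k) v"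
  proof
    fix w assume "w \<in> open_nbhd (GP n k) (rotate_gp n c v)"
    then have e: "{rotate_gp n c v, w} \<in> edges (GP n k)"
      by (simp add: open_nbhd_def)
    have "{v, rotate_gp n (n - c) w} \<in> edges (GP n k)"
      using rotate_gp_edges[OF e, of "n - c"] rotate_gp_inverse(2)[OF assms(3) v] by simp
    then have "rotate_gp n (n - c) w \<in> open_nbhd (GP n k) v"
      by (simp add: open_nbhd_def)
    moreover have "w = rotate_gp n c (rotate_gp n (n - c) w)"
      using rotate_gp_inverse(1)[OF assms(3) edges_GP_verts[OF e]] by simp
    ultimately show "w \<in> rotate_gp n c ` open_nbhd (GP n k) v" by blast
  qed
qed

section \<open>Neighbourhoods and threats in generalized Petersen graphs\<close>

lemma mod_add_right_cancel:
  fixes a b k n :: nat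
  assumes "a < n" "b < n" "(a + k) mod n = (b + k) mod n"
  shows "a = b"
  using assms cong_add_rcancel_nat[of a k b n] cong_less_modulus_unique_nat[of a b n]
  by (simp add: cong_def)

text \<open>
  The neighbourhoods are centred at index \<open>i + 1\<close> or \<open>i + k\<close> rather than at \<open>i\<close>, which
  avoids truncated subtraction and makes wrapping around the cycle a matter of evaluating \<open>mod\<close>.
\<close>
lemma open_nbhd_GP_U:
  assumes "n > 0"
  shows "open_nbhd (GP n k) (U ((i + 1) mod n)) \<subseteq>
    {U (i mod n), U ((i + 2) mod n), V ((i + 1) mod n)}"
proof
  fix w assume "w \<in> open_nbhd (GP n k) (U ((i + 1) mod n))"
  then consider j where "j < n" "U ((i + 1) mod n) = U j" "w = U ((j + 1) mod n)"
    | j where "j < n" "U ((i + 1) mod n) = U ((j + 1) mod n)" "w = U j"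
    | "w = V ((i + 1) mod n)"
    unfolding open_nbhd_def GP_def by (auto simp: doubleton_eq_iff)
  then show "w \<in> {U (i mod n), U ((i + 2) mod n), V ((i + 1) mod n)}"
  proof cases
    case 1
    then show ?thesis by (auto simp: mod_simps)
  next
    case 2
    then have "(i mod n + 1) mod n = (j + 1) mod n" by (simp add: mod_simps)
    then have "i mod n = j" by (rule mod_add_right_cancel[rotated 2]) (use 2 assms in auto)
    then show ?thesis using 2 by simp
  qed auto
qed

lemma open_nbhd_GP_V:
  assumes "n > 0"
  shows "open_nbhd (GP n k) (V ((i + k) mod n)) \<subseteq>
    {V (i mod n), V ((i + 2 * k) mod n), U ((i + k) mod n)}"
proof
  fix w assume "w \<in> open_nbhd (GP n k) (V ((i + k) mod n))"
  then consider j where "j < n" "V ((i + k) mod n) = V j" "w = V ((j + k) mod n)"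
    | j where "j < n" "V ((i + k) mod n) = V ((j + k) mod n)" "w = V j"
    | "w = U ((i + k) mod n)"
    unfolding open_nbhd_def GP_def by (auto simp: doubleton_eq_iff)
  then show "w \<in> {V (i mod n), V ((i + 2 * k) mod n), U ((i + k) mod n)}"
  proof cases
    case 1
    then show ?thesis by (auto simp: mod_simps mult_2 add.assoc)
  next
    case 2
    then have "(i mod n + k) mod n = (j + k) mod n" by (simp add: mod_simps)
    then have "i mod n = j" by (rule mod_add_right_cancel[rotated 2]) (use 2 assms in auto)
    then show ?thesis using 2 by simp
  qed auto
qed

text \<open>
  Once a finite index set \<open>I\<close> is supplied, simplification can check the premise on concrete
  positions.
\<close>
lemma threat_GP:
  assumes "n > 0"
    and "\<exists>i\<in>I. {U (i mod n), U ((i + 2) mod n), V ((i + 1) mod n)} \<subseteq> insert r S \<or>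
      {V (i mod n), V ((i + 4) mod n), U ((i + 2) mod n)} \<subseteq> insert r S"
  shows "threat (GP n 2) S r"
proof -
  have "U (j mod n) \<in> verts (GP n 2)" "V (j mod n) \<in> verts (GP n 2)" for j
    using assms(1) by (auto simp: GP_def)
  then show ?thesis
    using assms(2) open_nbhd_GP_U[OF assms(1), of 2] open_nbhd_GP_V[OF assms(1), of 2]
    unfolding threat_def by (simp del: insert_subset) (meson subset_trans)
qed

section \<open>Openings for \<open>GP n 2\<close>\<close>

text \<open>
  In the first line \<open>V 5\<close> forces \<open>U 6\<close> (around \<open>U 5\<close>), \<open>U 3\<close> forces \<open>V 1\<close> (around \<open>V 3\<close>),
  and \<open>V 2\<close> threatens to complete the neighbourhoods of \<open>U 2\<close> and \<open>V 4\<close>. The second line is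
  its mirror image about column 4. The two meet only in \<open>V 2\<close> and \<open>V 6\<close>, which with \<open>U 4\<close> make up the
  neighbourhood of \<open>V 4\<close>. The third line does without that neighbourhood: it starts like the first,
  but \<open>U 5\<close> then forces \<open>V 4\<close> (around \<open>U 4\<close>), and \<open>V 3\<close> closes the cycle
  \<open>U 4, V 5, U 3, U 5, V 3\<close>, in which consecutive vertices lie in a common neighbourhood.
\<close>
lemma opening_window:
  assumes "n \<ge> 8"
  shows "winning_opening (GP n 2) (U 4)
    {[V 5, U 6, U 3, V 1, V 2, U 1, V 6],
     [V 3, U 2, U 5, V 7, V 6, U 7, V 2],
     [V 5, U 6, U 3, V 1, U 5, V 4, V 3, V 7, U 2]}"
  unfolding winning_opening_def using assms
  by (auto simp: verts_GP intro!: threat_GP[where I = "{1, 2, 3, 4, 5}"])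

text \<open>
  In \<open>GP 6 2\<close> the vertices \<open>V 1, V 3, V 5\<close> form a triangle. Hence any two of them, together with
  the outer neighbour of the third, form an open neighbourhood, and a line that reaches the triangle
  can end in a double threat inside it. This drives the last two lines here and the
  first two of \<open>opening_6_V\<close>.
\<close>
lemma opening_6_U:
  "winning_opening (GP 6 2) (U 1)
    {[U 3, V 2, U 5, V 0, V 4],
     [U 3, V 2, V 5, V 1, V 3],
     [U 5, V 0, V 3, V 1, V 5]}"
  unfolding winning_opening_def
  by (auto simp: verts_GP intro!: threat_GP[where I = "{0, 1, 2, 3, 4, 5}"])

lemma opening_6_V:
  "winning_opening (GP 6 2) (U 3)
    {[U 1, V 2, V 5, V 1, V 3],
     [U 5, V 4, V 1, V 3, V 5],
     [V 2, U 1, V 4, U 0, U 5]}"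
  unfolding winning_opening_def
  by (auto simp: verts_GP intro!: threat_GP[where I = "{0, 1, 2, 3, 4, 5}"])

text \<open>
  The first and the last line are mirror images about column 0, the column of the opening move.
  They meet in \<open>U 1\<close> and \<open>U 6\<close>, which the middle line avoids.
\<close>
lemma opening_7_U:
  "winning_opening (GP 7 2) (V 0)
    {[U 1, U 6, V 3, U 5, V 6],
     [U 2, V 4, V 3, U 4, U 5],
     [U 6, U 1, V 4, U 2, V 1]}"
  unfolding winning_opening_def
  by (auto simp: verts_GP intro!: threat_GP[where I = "{0, 1, 2, 3, 4, 5, 6}"])

text \<open>
  The last two lines exchange the roles of \<open>U 1\<close> and \<open>U 3\<close>, which with \<open>V 2\<close> form the neighbourhood
  of \<open>U 2\<close>. They meet only in these two vertices, and the first line avoids both.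
\<close>
lemma opening_7_V:
  "winning_opening (GP 7 2) (V 2)
    {[U 0, V 5, V 6, U 4, U 5],
     [U 1, U 3, V 6, U 4, V 3],
     [U 3, U 1, V 5, U 0, V 1]}"
  unfolding winning_opening_def
  by (auto simp: verts_GP intro!: threat_GP[where I = "{0, 1, 2, 3, 4, 5, 6}"])

lemma winning_after_first_move:
  assumes "n \<ge> 6" "d \<in> {U 0, V 0}"
  shows "winning (GP n 2) Staller {} {d}"
proof -
  consider "n = 6" "d = U 0" | "n = 6" "d = V 0" | "n = 7" "d = U 0" | "n = 7" "d = V 0" | "n \<ge> 8"
    using assms by (cases "n = 6 \<or> n = 7") auto
  then show ?thesis
  proof cases
    case 1
    then show ?thesis using winning_opening_wins[OF opening_6_U, of "{U 0}"] by simp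
  next
    case 2
    then show ?thesis using winning_opening_wins[OF opening_6_V, of "{V 0}"] by simp
  next
    case 3
    then show ?thesis using winning_opening_wins[OF opening_7_U, of "{U 0}"] by simp
  next
    case 4
    then show ?thesis using winning_opening_wins[OF opening_7_V, of "{V 0}"] by simp
  next
    case 5
    then show ?thesis
      using assms(2) winning_opening_wins[OF opening_window, of n "{d}"] by auto
  qed
qed

theorem theorem1p5:
  fixes n :: nat
  assumes "n \<ge> 6"
  shows "graph_S (GP n 2)"
proof -
  let ?G = "GP n 2"
  have after: "winning ?G Staller {} {d}" if d: "d \<in> verts ?G" for d
  proof -
    obtain c where c: "c < n" "d = U c \<or> d = V c"
      using d unfolding GP_def fst_conv by blast
    then have "d = rotate_gp n c (U 0) \<or> d = rotate_gp n c (V 0)" by auto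
    moreover have "U 0 \<in> verts ?G" "V 0 \<in> verts ?G"
      using assms by (auto simp: GP_def)
    ultimately obtain w where w: "w \<in> {U 0, V 0}" "w \<in> verts ?G" "d = rotate_gp n c w"
      by blast
    show ?thesis
      using winning_rotate_gp[OF winning_after_first_move[OF assms w(1)], of c] w(2,3) c(1) by simp
  qed
  have "winning ?G first {} {}" for first
  proof (cases first)
    case Dominator
    have "U 0 \<in> verts ?G" using assms by (auto simp: GP_def)
    then show ?thesis unfolding Dominator
      by (intro winning.dominator after) auto
  next
    case Staller
    consider "n = 6" | "n = 7" | "n \<ge> 8" using assms by linarith
    then show ?thesis unfolding Staller
      using winning_opening_wins[OF opening_6_U, of "{}"] winning_opening_wins[OF opening_7_U, of "{}"]
        winning_opening_wins[OF opening_window, of n "{}"]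
      by cases auto
  qed
  then show ?thesis
    unfolding graph_S_def using winning_strategyI by blast
qed

end
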